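(* There is no algorithm that, given any constructive linear programming problem (CLPP) whose set of allowable plans is nonempty and bounded, together with a plan for it, always decides whether the given plan is allowable.
   Context: "Algorithm" means Turing machine (partial recursive function); algorithms are encoded by natural numbers, and an algorithm applied to other algorithms receives their codes. To decide a property means to terminate on every input of the given kind and output $1$ or $0$ according to whether the property holds or not. A constructive real number (CRN) is a pair of algorithms $(F,R)$, where $F$ transforms every natural number into a rational number, $R$ transforms every positive rational number into a natural number, and for every rational $\varepsilon>0$ and all $m,n>R(\varepsilon)$ one has $|F(m)-F(n)|<\varepsilon$. If $x=(F,R)$, write $x(n)=F(n)$. For CRNs $x,y$: $x=y$ means that for every rational $\varepsilon>0$ one can algorithmically produce a natural $M$ such that $|x(m)-y(n)|<\varepsilon$ for all $m,n>M$; $x<y$ means that one can produce a rational $\varepsilon>0$ and a natural $M$ such that $y(m)>x(n)+\varepsilon$ for all $m,n>M$; $x\le y$ means that for every rational $\varepsilon>0$ one can algorithmically produce a natural $M$ such that $y(m)>x(n)-\varepsilon$ for all $m,n>M$. Arithmetic operations on CRNs are the natural ones. An algorithm receiving a CRN as input receives the codes of the pair $(F,R)$; algorithms on CRNs are not required to give equal results for equal CRNs. A constructive linear programming problem (CLPP) is a problem of maximizing or minimizing a linear function (the cost function) of finitely many variables subject to finitely many linear equations and nonstrict linear inequalities, all of whose coefficients and constants are CRNs; it is given by (the codes of) these CRNs. A plan is a tuple of CRNs, one for each variable. A plan is allowable if it satisfies all the constraints. The set of allowable plans is nonempty if it is impossible that no allowable plan exists (no procedure for finding one is supplied as input), and it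 is bounded if there is a rational number bounding the absolute values of all coordinates of all allowable plans. *)

theory Defs
  imports Complex_Main "HOL-Library.Nat_Bijection"
begin

section \<open>Partial recursive functions\<close>

datatype recf =
    Zero
  | Succ
  | Proj nat
  | Comp recf "recf list"
  | PrimRec recf recf
  | Mu recf

text \<open>
  \<open>evals f xs y\<close>: the algorithm \<open>f\<close> terminates on the argument list \<open>xs\<close> with output \<open>y\<close>.
  Terms carry no arity; accessing a missing argument diverges, and surplus arguments are ignored. For each fixed number of arguments the terms denote exactly the partial recursive
  functions. \<open>PrimRec\<close> recurses on its first argument, \<open>Mu\<close> searches for its first argument.
\<close>

inductive evals :: "recf \<Rightarrow> nat list \<Rightarrow> nat \<Rightarrow> bool" where
  zero: "evals Zero xs 0"
| succ: "evals Succ (x # xs) (Suc x)"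
| proj: "i < length xs \<Longrightarrow> evals (Proj i) xs (xs ! i)"
| comp: "list_all2 (\<lambda>g y. evals g xs y) gs ys \<Longrightarrow> evals f ys z \<Longrightarrow> evals (Comp f gs) xs z"
| primrec_0: "evals f xs y \<Longrightarrow> evals (PrimRec f g) (0 # xs) y"
| primrec_Suc: "evals (PrimRec f g) (n # xs) y \<Longrightarrow> evals g (n # y # xs) z
    \<Longrightarrow> evals (PrimRec f g) (Suc n # xs) z"
| mu: "evals f (n # xs) 0 \<Longrightarrow> (\<forall>m<n. \<exists>y. evals f (m # xs) (Suc y)) \<Longrightarrow> evals (Mu f) xs n"

lemma evals_deterministic: "evals f xs y \<Longrightarrow> evals f xs z \<Longrightarrow> y = z"
proof (induction arbitrary: z rule: evals.induct)
  case (comp xs gs ys f w)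
  from comp.prems obtain ys' where ys': "list_all2 (\<lambda>g y. evals g xs y) gs ys'" "evals f ys' z"
    by (cases rule: evals.cases) auto
  have "ys = ys'"
    using comp.IH(1) ys'(1) by (auto simp: list_all2_conv_all_nth intro!: nth_equalityI)
  with ys'(2) comp.IH(2) show ?case by blast
next
  case (primrec_Suc f g n xs y w)
  from primrec_Suc.prems obtain y' where "evals (PrimRec f g) (n # xs) y'" "evals g (n # y' # xs) z"
    by (cases rule: evals.cases) auto
  with primrec_Suc.IH show ?case by blast
next
  case (mu f n xs)
  from mu.prems have z: "evals f (z # xs) 0" "\<forall>m<z. \<exists>y. evals f (m # xs) (Suc y)"
    by (cases rule: evals.cases; auto)+
  show ?case
  proof (rule linorder_cases[of n z])
    assume "n < z"
    then show ?thesis using z(2) mu.IH(1) by (metis nat.distinct(1))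
  next
    assume "z < n"
    then show ?thesis using z(1) mu.IH(2) by (metis nat.distinct(1))
  qed
qed (erule evals.cases; auto)+

primrec recf_encode :: "recf \<Rightarrow> nat" where
  "recf_encode Zero = prod_encode (0, 0)"
| "recf_encode Succ = prod_encode (1, 0)"
| "recf_encode (Proj i) = prod_encode (2, i)"
| "recf_encode (Comp f gs) =
     prod_encode (3, prod_encode (recf_encode f, list_encode (map recf_encode gs)))"
| "recf_encode (PrimRec f g) = prod_encode (4, prod_encode (recf_encode f, recf_encode g))"
| "recf_encode (Mu f) = prod_encode (5, recf_encode f)"

lemma recf_encode_inject: "recf_encode f = recf_encode g \<Longrightarrow> f = g"
proof (induction f arbitrary: g)
  case (Comp f fs)
  from Comp.prems obtain g' gs where g: "g = Comp g' gs"
    by (cases g) auto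
  with Comp.prems have "recf_encode f = recf_encode g'" "map recf_encode fs = map recf_encode gs"
    by (auto simp: list_encode_eq)
  with Comp.IH show ?case
    unfolding g by (auto simp: list_eq_iff_nth_eq)
next
  case Zero then show ?case by (cases g) auto
next
  case Succ then show ?case by (cases g) auto
next
  case (Proj i) then show ?case by (cases g) auto
next
  case (PrimRec f f') then show ?case by (cases g) auto
next
  case (Mu f) then show ?case by (cases g) auto
qed


section \<open>Constructive real numbers\<close>

text \<open>A rational is coded through its fraction in lowest terms with positive denominator.\<close>

definition rat_encode :: "rat \<Rightarrow> nat" where
  "rat_encode q = (case quotient_of q of (a, b) \<Rightarrow> prod_encode (int_encode a, int_encode b))"

lemma rat_encode_inject: "rat_encode p = rat_encode q \<Longrightarrow> p = q"
  by (auto simp: rat_encode_def int_encode_eq split: prod.splits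
      intro: quotient_of_inject)

type_synonym crn = "recf \<times> recf"

definition crn_approx :: "crn \<Rightarrow> nat \<Rightarrow> rat" where
  "crn_approx x n = (THE q. evals (fst x) [n] (rat_encode q))"

definition is_crn :: "crn \<Rightarrow> bool" where
  "is_crn x \<longleftrightarrow>
     (\<forall>n. \<exists>q. evals (fst x) [n] (rat_encode q)) \<and>
     (\<forall>\<epsilon>>0. \<exists>N. evals (snd x) [rat_encode \<epsilon>] N \<and>
        (\<forall>m n. m > N \<and> n > N \<longrightarrow> \<bar>crn_approx x m - crn_approx x n\<bar> < \<epsilon>))"

lemma crn_approx_eqI: "evals (fst x) [n] (rat_encode q) \<Longrightarrow> crn_approx x n = q"
  unfolding crn_approx_def by (blast intro: evals_deterministic rat_encode_inject)

definition crn_encode :: "crn \<Rightarrow> nat" where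
  "crn_encode x = prod_encode (recf_encode (fst x), recf_encode (snd x))"

text \<open>
  Equality and order of constructive reals refer only to the approximating sequences, and sums,
  products and absolute values of constructive reals are formed termwise on these sequences.
  The relations are therefore stated for rational sequences; the moduli of the sums and products
  occurring in a linear form are never needed. The algorithm \<open>A\<close> produces the bound \<open>M\<close>
  from \<open>\<epsilon>\<close>.
\<close>

definition approx_eq :: "(nat \<Rightarrow> rat) \<Rightarrow> (nat \<Rightarrow> rat) \<Rightarrow> bool" where
  "approx_eq x y \<longleftrightarrow>
     (\<exists>A. \<forall>\<epsilon>>0. \<exists>M. evals A [rat_encode \<epsilon>] M \<and>
        (\<forall>m n. m > M \<and> n > M \<longrightarrow> \<bar>x m - y n\<bar> < \<epsilon>))"

definition approx_le :: "(nat \<Rightarrow> rat) \<Rightarrow> (nat \<Rightarrow> rat) \<Rightarrow> bool" where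
  "approx_le x y \<longleftrightarrow>
     (\<exists>A. \<forall>\<epsilon>>0. \<exists>M. evals A [rat_encode \<epsilon>] M \<and>
        (\<forall>m n. m > M \<and> n > M \<longrightarrow> y m > x n - \<epsilon>))"


section \<open>Constructive linear programming problems\<close>

datatype lin_rel = EQ | LE | GE

text \<open>\<open>Constr a r b\<close> is the constraint \<open>a\<^sub>0 x\<^sub>0 + a\<^sub>1 x\<^sub>1 + \<dots> r b\<close>.\<close>

datatype constr = Constr (coeffs: "crn list") (rel: lin_rel) (rhs: crn)

datatype clpp = CLPP (maximize: bool) (cost: "crn list") (constrs: "constr list")

definition num_vars :: "clpp \<Rightarrow> nat" where
  "num_vars P = length (cost P)"

definition is_clpp :: "clpp \<Rightarrow> bool" where
  "is_clpp P \<longleftrightarrow>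
     (\<forall>x\<in>set (cost P). is_crn x) \<and>
     (\<forall>c\<in>set (constrs P). length (coeffs c) = num_vars P \<and>
        (\<forall>x\<in>set (coeffs c). is_crn x) \<and> is_crn (rhs c))"

definition is_plan :: "clpp \<Rightarrow> crn list \<Rightarrow> bool" where
  "is_plan P p \<longleftrightarrow> length p = num_vars P \<and> (\<forall>x\<in>set p. is_crn x)"

definition lin_form :: "crn list \<Rightarrow> crn list \<Rightarrow> nat \<Rightarrow> rat" where
  "lin_form a p n = (\<Sum>i<length a. crn_approx (a ! i) n * crn_approx (p ! i) n)"

fun satisfies :: "crn list \<Rightarrow> constr \<Rightarrow> bool" where
  "satisfies p (Constr a EQ b) = approx_eq (lin_form a p) (crn_approx b)"
| "satisfies p (Constr a LE b) = approx_le (lin_form a p) (crn_approx b)"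
| "satisfies p (Constr a GE b) = approx_le (crn_approx b) (lin_form a p)"

definition allowable :: "clpp \<Rightarrow> crn list \<Rightarrow> bool" where
  "allowable P p \<longleftrightarrow> is_plan P p \<and> (\<forall>c\<in>set (constrs P). satisfies p c)"

text \<open>
  Nonemptiness means only that it is impossible that no allowable plan exists, which classically
  is plain existence; no witness is part of the input to an algorithm.
\<close>

definition nonempty_clpp :: "clpp \<Rightarrow> bool" where
  "nonempty_clpp P \<longleftrightarrow> (\<exists>p. allowable P p)"

definition bounded_clpp :: "clpp \<Rightarrow> bool" where
  "bounded_clpp P \<longleftrightarrow>
     (\<exists>B::rat. \<forall>p. allowable P p \<longrightarrow>
        (\<forall>x\<in>set p. approx_le (\<lambda>n. \<bar>crn_approx x n\<bar>) (\<lambda>_. B)))"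

fun rel_encode :: "lin_rel \<Rightarrow> nat" where
  "rel_encode EQ = 0"
| "rel_encode LE = 1"
| "rel_encode GE = 2"

definition plan_encode :: "crn list \<Rightarrow> nat" where
  "plan_encode p = list_encode (map crn_encode p)"

definition constr_encode :: "constr \<Rightarrow> nat" where
  "constr_encode c =
     prod_encode (list_encode (map crn_encode (coeffs c)),
       prod_encode (rel_encode (rel c), crn_encode (rhs c)))"

definition clpp_encode :: "clpp \<Rightarrow> nat" where
  "clpp_encode P =
     prod_encode (of_bool (maximize P),
       prod_encode (list_encode (map crn_encode (cost P)),
         list_encode (map constr_encode (constrs P))))"

end

(*
  Deciding allowability for the single constraint x = 0 means deciding whether a constructive real
  is zero. A decision algorithm D is refuted by a plan x that knows its own code: x(n) is 1/(s+1)
  if s < n is the first time at which D has accepted x, and 0 if there is no such time, so x is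
  nonzero exactly if D accepts it. Running D for a limited time needs no universal machine: the
  time-limited version of D is built by recursion on the term D.
*)

theory Submission
  imports Defs
begin

section \<open>Clocked evaluation is monotone in the clock, sound and complete\<close>

section \<open>Clocked evaluation\<close>

text \<open>A three-state scan of clocked values, where \<open>h m\<close> is 0 for no value, 1 for
  output 0, and larger for a positive output. State 1 means still searching, 0 that a value was
  missing, \<open>n + 2\<close> that the first zero is \<open>n\<close>; the last two persist. Hence
  \<open>search h k - 1\<close> is again 0 for no answer and \<open>Suc n\<close> for the answer
  \<open>n\<close>.\<close>

primrec search :: "(nat \<Rightarrow> nat) \<Rightarrow> nat \<Rightarrow> nat" where
  "search h 0 = 1"
| "search h (Suc k) =
     (if search h k = 1 then (if h k = 0 then 0 else if h k = 1 then k + 2 else 1) else search h k)"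

lemma search_eq_1_iff: "search h k = 1 \<longleftrightarrow> (\<forall>m<k. 1 < h m)"
  by (induction k) (auto simp: less_Suc_eq)

lemma search_eq_Suc_Suc_iff:
  "search h k = Suc (Suc n) \<longleftrightarrow> n < k \<and> h n = 1 \<and> (\<forall>m<n. 1 < h m)"
proof (induction k)
  case (Suc k)
  show ?case
  proof (cases "search h k = 1")
    case True
    then have "\<forall>m<k. 1 < h m" by (simp only: search_eq_1_iff)
    then show ?thesis using True by (auto simp: less_Suc_eq)
  next
    case False
    then have "\<not> (\<forall>m<k. 1 < h m)" using search_eq_1_iff by blast
    then show ?thesis using False Suc by (auto simp: less_Suc_eq)
  qed
qed simp

text \<open>
  The value \<open>0\<close> means that the clock \<open>s\<close> has run out (or that an argument is missing), and
  \<open>Suc y\<close> that the output is \<open>y\<close>. Only \<open>Mu\<close> needs the clock, which bounds its search.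
\<close>

primrec clocked :: "recf \<Rightarrow> nat \<Rightarrow> nat list \<Rightarrow> nat" where
  "clocked Zero s xs = 1"
| "clocked Succ s xs = (if xs = [] then 0 else Suc (Suc (hd xs)))"
| "clocked (Proj i) s xs = (if i < length xs then Suc (xs ! i) else 0)"
| "clocked (Comp f gs) s xs =
     (let vs = map (\<lambda>h. h s xs) (map clocked gs)
      in if 0 \<in> set vs then 0 else clocked f s (map (\<lambda>v. v - 1) vs))"
| "clocked (PrimRec f g) s xs =
     (case xs of [] \<Rightarrow> 0
      | n # zs \<Rightarrow> rec_nat (clocked f s zs)
          (\<lambda>m v. if v = 0 then 0 else clocked g s (m # (v - 1) # zs)) n)"
| "clocked (Mu f) s xs = search (\<lambda>m. clocked f s (m # xs)) s - 1"

text \<open>Induction on the term. In the case \<open>Mu\<close> a larger clock preserves the values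
  up to the minimum and only lengthens the search, so the same minimum is found; other terms at most
  pass the clock on.\<close>

lemma clocked_mono: "clocked f s xs = Suc y \<Longrightarrow> s \<le> t \<Longrightarrow> clocked f t xs = Suc y"
proof (induction f arbitrary: xs y)
  case (Comp f gs)
  have nz: "clocked g s xs \<noteq> 0" if "g \<in> set gs" for g
    using Comp.prems(1) that by (auto simp: Let_def split: if_splits)
  have eq: "clocked g t xs = clocked g s xs" if "g \<in> set gs" for g
    using nz[OF that] Comp.IH(2)[OF that] Comp.prems(2) by (metis not0_implies_Suc)
  show ?case
    using Comp.prems Comp.IH(1) nz eq
    by (auto simp: Let_def image_iff comp_def cong: map_cong split: if_splits)
next
  case (PrimRec f g)
  then obtain n zs where xs: "xs = n # zs" by (cases xs) auto
  let ?r = "\<lambda>s. rec_nat (clocked f s zs)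
             (\<lambda>m v. if v = 0 then 0 else clocked g s (m # (v - 1) # zs))"
  \<comment> \<open>A defined value at \<open>Suc n\<close> presupposes one at \<open>n\<close>, so
    an inner induction on the recursion argument carries the computation over to clock
    \<open>t\<close>.\<close>
  have "?r s n = Suc y \<Longrightarrow> ?r t n = Suc y" for n y
  proof (induction n arbitrary: y)
    case 0
    then show ?case using PrimRec.IH(1) PrimRec.prems(2) by simp
  next
    case (Suc n)
    then obtain v where "?r s n = Suc v" by (cases "?r s n") auto
    with Suc PrimRec.IH(2) PrimRec.prems(2) show ?case by simp
  qed
  with PrimRec.prems(1) show ?case by (simp add: xs)
next
  case (Mu f)
  then have "search (\<lambda>m. clocked f s (m # xs)) s = Suc (Suc y)" by simp
  then have *: "y < s" "clocked f s (y # xs) = Suc 0" "\<forall>m<y. 1 < clocked f s (m # xs)"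
    by (simp_all add: search_eq_Suc_Suc_iff)
  have "1 < clocked f t (m # xs)" if "m < y" for m
  proof -
    from *(3) that have "1 < clocked f s (m # xs)" by blast
    then obtain v where "clocked f s (m # xs) = Suc (Suc v)" by (auto dest!: less_imp_Suc_add)
    then show ?thesis using Mu.IH[OF _ Mu.prems(2)] by simp
  qed
  with * Mu have "search (\<lambda>m. clocked f t (m # xs)) t = Suc (Suc y)"
    by (auto simp: search_eq_Suc_Suc_iff)
  then show ?case by simp
qed (auto split: if_splits)

lemma clocked_stable:
  assumes "clocked f s xs \<noteq> 0" and "s \<le> t"
  shows "clocked f t xs = clocked f s xs"
proof -
  obtain y where "clocked f s xs = Suc y" using assms(1) not0_implies_Suc by blast
  then show ?thesis using clocked_mono[OF _ assms(2)] by simp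
qed

lemma clocked_sound: "clocked f s xs = Suc y \<Longrightarrow> evals f xs y"
proof (induction f arbitrary: xs y)
  case Zero
  then show ?case by (auto intro: evals.zero)
next
  case Succ
  then show ?case by (cases xs) (auto intro: evals.succ)
next
  case (Proj i)
  then show ?case by (auto intro: evals.proj split: if_splits)
next
  case (Comp f gs)
  have nz: "clocked g s xs \<noteq> 0" if "g \<in> set gs" for g
    using Comp.prems(1) that by (auto simp: Let_def split: if_splits)
  let ?ys = "map (\<lambda>g. clocked g s xs - 1) gs"
  have "list_all2 (\<lambda>g y. evals g xs y) gs ?ys"
    using nz Comp.IH(2) by (auto simp: list_all2_conv_all_nth)
  moreover have "evals f ?ys y"
    using Comp.prems by (intro Comp.IH(1)) (auto simp: Let_def comp_def split: if_splits)
  ultimately show ?case by (rule evals.comp)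
next
  case (PrimRec f g)
  then obtain n zs where xs: "xs = n # zs" by (cases xs) auto
  let ?r = "rec_nat (clocked f s zs)
             (\<lambda>m v. if v = 0 then 0 else clocked g s (m # (v - 1) # zs))"
  have "?r n = Suc y \<Longrightarrow> evals (PrimRec f g) (n # zs) y" for n y
  proof (induction n arbitrary: y)
    case 0
    then show ?case using PrimRec.IH(1) by (simp add: evals.primrec_0)
  next
    case (Suc n)
    then obtain v where "?r n = Suc v" by (cases "?r n") auto
    with Suc PrimRec.IH(2) show ?case by (auto intro: evals.primrec_Suc)
  qed
  with PrimRec.prems(1) show ?case by (simp add: xs)
next
  case (Mu f)
  then have "search (\<lambda>m. clocked f s (m # xs)) s = Suc (Suc y)" by simp
  then have *: "clocked f s (y # xs) = Suc 0" "\<forall>m<y. 1 < clocked f s (m # xs)"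
    by (simp_all add: search_eq_Suc_Suc_iff)
  show ?case
  proof (rule evals.mu)
    show "\<forall>m<y. \<exists>v. evals f (m # xs) (Suc v)"
    proof (intro allI impI)
      fix m assume "m < y"
      then have "1 < clocked f s (m # xs)" using *(2) by blast
      then obtain v where "clocked f s (m # xs) = Suc (Suc v)" by (auto dest!: less_imp_Suc_add)
      then show "\<exists>v. evals f (m # xs) (Suc v)" using Mu.IH by blast
    qed
  qed (use * Mu.IH in auto)
qed

text \<open>Finitely many clocks are replaced by their maximum. This serves the arguments of
  \<open>Comp\<close> and the values of \<open>Mu\<close> before its minimum.\<close>

lemma eventually_bounded_clock:
  fixes P :: "nat \<Rightarrow> nat \<Rightarrow> bool"
  assumes "\<And>i. i < n \<Longrightarrow> \<exists>s. P i s" and "\<And>i s t. P i s \<Longrightarrow> s \<le> t \<Longrightarrow> P i t"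
  shows "\<exists>s. \<forall>i<n. P i s"
  using assms(1)
proof (induction n)
  case (Suc n)
  then obtain s s' where "\<forall>i<n. P i s" "P n s'" by (meson lessI less_Suc_eq)
  then have "\<forall>i<Suc n. P i (max s s')"
    using assms(2) by (metis less_Suc_eq max.cobounded1 max.cobounded2)
  then show ?case ..
qed simp

text \<open>Induction on the derivation: each subderivation yields its own clock, and
  \<open>clocked_mono\<close> raises them all to a common one.\<close>

lemma clocked_complete: "evals f xs y \<Longrightarrow> \<exists>s. clocked f s xs = Suc y"
proof (induction rule: evals.induct)
  case (comp xs gs ys f z)
  then have len: "length gs = length ys"
    by (auto simp: list_all2_conv_all_nth)
  have ex: "\<exists>s. clocked (gs ! i) s xs = Suc (ys ! i)" if "i < length ys" for i
    using comp that by (auto simp: list_all2_conv_all_nth)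
  have "\<exists>s. \<forall>i<length ys. clocked (gs ! i) s xs = Suc (ys ! i)"
    by (rule eventually_bounded_clock) (fact ex, rule clocked_mono)
  then obtain s where s: "\<forall>i<length ys. clocked (gs ! i) s xs = Suc (ys ! i)" ..
  obtain s' where s': "clocked f s' ys = Suc z" using comp.IH(2) by blast
  define t where "t = max s s'"
  have t: "clocked (gs ! i) t xs = Suc (ys ! i)" if "i < length ys" for i
    using s that clocked_mono[of _ s _ _ t] by (simp add: t_def)
  have "clocked f t ys = Suc z" using s' clocked_mono[of _ s' _ _ t] by (simp add: t_def)
  moreover have "map (\<lambda>g. clocked g t xs - 1) gs = ys"
    using t len by (auto intro!: nth_equalityI)
  moreover have "0 \<notin> (\<lambda>g. clocked g t xs) ` set gs"
    using t len by (auto simp: in_set_conv_nth)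
  ultimately show ?case
    by (intro exI[of _ t]) (auto simp: Let_def comp_def)
next
  case (primrec_0 f xs y g)
  then show ?case by simp
next
  case (primrec_Suc f g n xs y z)
  then obtain s s' where "clocked (PrimRec f g) s (n # xs) = Suc y"
    "clocked g s' (n # y # xs) = Suc z" by blast
  then have "clocked (PrimRec f g) (max s s') (n # xs) = Suc y"
    "clocked g (max s s') (n # y # xs) = Suc z"
    by (auto intro: clocked_mono simp del: clocked.simps)
  then show ?case by (intro exI[of _ "max s s'"]) simp
next
  case (mu f n xs)
  have "\<exists>s. \<forall>m<n. 1 < clocked f s (m # xs)"
  proof (rule eventually_bounded_clock)
    show "1 < clocked f t (m # xs)" if "1 < clocked f s (m # xs)" "s \<le> t" for m s t
      using that clocked_stable[of f s "m # xs" t] by simp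
    show "\<exists>s. 1 < clocked f s (m # xs)" if m: "m < n" for m
    proof -
      obtain y s where "clocked f s (m # xs) = Suc (Suc y)" using mu.IH(2) m by blast
      then show ?thesis by (intro exI[of _ s]) simp
    qed
  qed
  then obtain s where s: "\<forall>m<n. 1 < clocked f s (m # xs)" by blast
  obtain s' where s': "clocked f s' (n # xs) = Suc 0" using mu.IH(1) by blast
  \<comment> \<open>A search with clock \<open>t\<close> inspects only arguments below
    \<open>t\<close>, so \<open>t\<close> must also exceed the minimum \<open>n\<close>
    itself.\<close>
  define t where "t = max (Suc n) (max s s')"
  have "1 < clocked f t (m # xs)" if "m < n" for m
  proof -
    have "s \<le> t" by (simp add: t_def)
    moreover have "1 < clocked f s (m # xs)" using s that by blast
    ultimately show ?thesis using clocked_stable[of f s "m # xs" t] by simp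
  qed
  moreover have "clocked f t (n # xs) = Suc 0"
    using s' clocked_mono[of _ s' _ _ t] by (simp add: t_def)
  ultimately have "search (\<lambda>m. clocked f t (m # xs)) t = Suc (Suc n)"
    by (simp add: search_eq_Suc_Suc_iff) (simp add: t_def)
  then show ?case by (intro exI[of _ t]) simp
qed auto


section \<open>Closure properties, and computability of the clocked evaluation\<close>

section \<open>Total recursive functions\<close>

definition total_recursive :: "nat \<Rightarrow> (nat list \<Rightarrow> nat) \<Rightarrow> bool" where
  "total_recursive n \<phi> \<longleftrightarrow> (\<exists>g. \<forall>xs. length xs = n \<longrightarrow> evals g xs (\<phi> xs))"

lemma total_recursive_cong:
  assumes "total_recursive n \<phi>" and "\<And>xs. length xs = n \<Longrightarrow> \<phi> xs = \<psi> xs"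
  shows "total_recursive n \<psi>"
  using assms unfolding total_recursive_def by metis

primrec const_recf :: "nat \<Rightarrow> recf" where
  "const_recf 0 = Zero"
| "const_recf (Suc k) = Comp Succ [const_recf k]"

lemma evals_const_recf: "evals (const_recf k) xs k"
  by (induction k) (auto intro!: evals.zero evals.comp[where ys = "[_]"] evals.succ)

lemma total_recursive_const: "total_recursive n (\<lambda>_. k)"
  unfolding total_recursive_def using evals_const_recf by blast

lemma total_recursive_proj: "i < n \<Longrightarrow> total_recursive n (\<lambda>xs. xs ! i)"
  unfolding total_recursive_def using evals.proj by blast

lemma total_recursive_comp:
  assumes f: "total_recursive (length \<psi>s) \<phi>"
    and gs: "\<And>\<psi>. \<psi> \<in> set \<psi>s \<Longrightarrow> total_recursive n \<psi>"
  shows "total_recursive n (\<lambda>xs. \<phi> (map (\<lambda>\<psi>. \<psi> xs) \<psi>s))"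
proof -
  obtain f where f: "\<And>xs. length xs = length \<psi>s \<Longrightarrow> evals f xs (\<phi> xs)"
    using f unfolding total_recursive_def by blast
  obtain g where g: "\<And>\<psi> xs. \<psi> \<in> set \<psi>s \<Longrightarrow> length xs = n \<Longrightarrow> evals (g \<psi>) xs (\<psi> xs)"
    using gs unfolding total_recursive_def by metis
  have "evals (Comp f (map g \<psi>s)) xs (\<phi> (map (\<lambda>\<psi>. \<psi> xs) \<psi>s))" if "length xs = n" for xs
    by (rule evals.comp[where ys = "map (\<lambda>\<psi>. \<psi> xs) \<psi>s"])
      (use f g that in \<open>auto simp: list_all2_conv_all_nth\<close>)
  then show ?thesis unfolding total_recursive_def by blast
qed

lemma total_recursive_comp1:
  assumes "total_recursive 1 (\<lambda>xs. f (xs ! 0))" and "total_recursive n a"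
  shows "total_recursive n (\<lambda>xs. f (a xs))"
  using total_recursive_comp[of "[a]" "\<lambda>xs. f (xs ! 0)" n] assms by simp

text \<open>Weakening by \<open>k\<close> leading dummy arguments, obtained by composing with
  shifted projections.\<close>

lemma total_recursive_drop:
  assumes "total_recursive n \<phi>"
  shows "total_recursive (k + n) (\<lambda>xs. \<phi> (drop k xs))"
proof (rule total_recursive_cong)
  show "total_recursive (k + n) (\<lambda>xs. \<phi> (map (\<lambda>\<psi>. \<psi> xs) (map (\<lambda>i xs. xs ! (k + i)) [0..<n])))"
    using assms by (intro total_recursive_comp) (auto intro: total_recursive_proj)
  show "\<phi> (map (\<lambda>\<psi>. \<psi> xs) (map (\<lambda>i xs. xs ! (k + i)) [0..<n])) = \<phi> (drop k xs)"
    if "length xs = k + n" for xs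
    using that by (intro arg_cong[where f = \<phi>] nth_equalityI) auto
qed

text \<open>The step function \<open>c\<close> sees the index, the previous value and then the
  parameters, in the order in which \<open>PrimRec\<close> supplies them.\<close>

lemma total_recursive_rec_nat:
  assumes a: "total_recursive n a" and b: "total_recursive n b"
    and c: "total_recursive (Suc (Suc n)) (\<lambda>ys. c (ys ! 0) (ys ! 1) (drop 2 ys))"
  shows "total_recursive n (\<lambda>xs. rec_nat (b xs) (\<lambda>m v. c m v xs) (a xs))"
proof -
  obtain f where f: "\<And>xs. length xs = n \<Longrightarrow> evals f xs (b xs)"
    using b unfolding total_recursive_def by blast
  obtain g where g: "\<And>m v xs. length xs = n \<Longrightarrow> evals g (m # v # xs) (c m v xs)"
    using c unfolding total_recursive_def
    by (metis One_nat_def drop0 drop_Suc_Cons length_Cons nth_Cons_0 nth_Cons_Suc numeral_2_eq_2)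
  have "evals (PrimRec f g) (m # xs) (rec_nat (b xs) (\<lambda>m v. c m v xs) m)" if "length xs = n" for m xs
    using f g that by (induction m) (auto intro: evals.primrec_0 evals.primrec_Suc)
  then have "evals (PrimRec f g) ys (rec_nat (b (drop 1 ys)) (\<lambda>m v. c m v (drop 1 ys)) (ys ! 0))"
    if "length ys = Suc n" for ys using that by (cases ys) auto
  then have r: "total_recursive (Suc n)
      (\<lambda>ys. rec_nat (b (drop 1 ys)) (\<lambda>m v. c m v (drop 1 ys)) (ys ! 0))"
    unfolding total_recursive_def by blast
  \<comment> \<open>Substituting \<open>a\<close> for the first argument and projections for the
    parameters turns recursion on an entry into recursion up to a computed bound.\<close>
  let ?ps = "a # map (\<lambda>i xs. xs ! i) [0..<n]"
  have "total_recursive n (\<lambda>xs. (\<lambda>ys. rec_nat (b (drop 1 ys)) (\<lambda>m v. c m v (drop 1 ys)) (ys ! 0))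
      (map (\<lambda>\<psi>. \<psi> xs) ?ps))"
    using r a by (intro total_recursive_comp) (auto intro: total_recursive_proj)
  moreover have "map (\<lambda>\<psi>. \<psi> xs) (map (\<lambda>i xs. xs ! i) [0..<n]) = xs" if "length xs = n" for xs :: "nat list"
    using that by (auto intro: nth_equalityI)
  ultimately show ?thesis by (elim total_recursive_cong) (simp del: map_map)
qed

lemma total_recursive_Suc:
  assumes "total_recursive n a"
  shows "total_recursive n (\<lambda>xs. Suc (a xs))"
proof (rule total_recursive_comp1[OF _ assms])
  have "evals Succ xs (Suc (xs ! 0))" if "length xs = 1" for xs
    using that by (cases xs) (auto intro: evals.succ)
  then show "total_recursive 1 (\<lambda>xs. Suc (xs ! 0))" unfolding total_recursive_def by blast
qed

text \<open>A case distinction is a primitive recursion whose step ignores both the index and the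
  previous value.\<close>

lemma total_recursive_if_zero:
  assumes "total_recursive n a" "total_recursive n b" "total_recursive n c"
  shows "total_recursive n (\<lambda>xs. if a xs = 0 then b xs else c xs)"
proof (rule total_recursive_cong)
  show "total_recursive n (\<lambda>xs. rec_nat (b xs) (\<lambda>_ _. c xs) (a xs))"
    using assms total_recursive_drop[OF assms(3), of 2]
    by (intro total_recursive_rec_nat) auto
  show "rec_nat (b xs) (\<lambda>_ _. c xs) (a xs) = (if a xs = 0 then b xs else c xs)" for xs
    by (cases "a xs") auto
qed

lemma total_recursive_pred:
  assumes "total_recursive n a"
  shows "total_recursive n (\<lambda>xs. a xs - 1)"
proof (rule total_recursive_cong)
  show "total_recursive n (\<lambda>xs. rec_nat 0 (\<lambda>m _. m) (a xs))"
    using assms by (intro total_recursive_rec_nat) (auto intro: total_recursive_const total_recursive_proj)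
  show "rec_nat 0 (\<lambda>m _. m) (a xs) = a xs - 1" for xs
    by (cases "a xs") auto
qed

lemma total_recursive_add:
  assumes "total_recursive n a" "total_recursive n b"
  shows "total_recursive n (\<lambda>xs. a xs + b xs)"
proof (rule total_recursive_cong)
  show "total_recursive n (\<lambda>xs. rec_nat (b xs) (\<lambda>_ v. Suc v) (a xs))"
    using assms by (intro total_recursive_rec_nat total_recursive_Suc) (auto intro: total_recursive_proj)
  have "rec_nat k (\<lambda>_ v. Suc v) m = m + k" for m k
    by (induction m) auto
  then show "rec_nat (b xs) (\<lambda>_ v. Suc v) (a xs) = a xs + b xs" for xs by simp
qed

text \<open>The Cantor pairing of \<open>m\<close> and \<open>n\<close> is
  \<open>triangle (m + n) + m\<close>, and triangle numbers arise by repeated addition.\<close>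

lemma total_recursive_prod_encode:
  assumes "total_recursive n a" "total_recursive n b"
  shows "total_recursive n (\<lambda>xs. prod_encode (a xs, b xs))"
proof -
  have tri: "total_recursive n (\<lambda>xs. triangle (c xs))" if "total_recursive n c" for c
  proof (rule total_recursive_cong)
    show "total_recursive n (\<lambda>xs. rec_nat 0 (\<lambda>m v. v + Suc m) (c xs))"
      using that by (intro total_recursive_rec_nat total_recursive_Suc total_recursive_add)
        (auto intro: total_recursive_proj total_recursive_const)
    have "rec_nat 0 (\<lambda>m v. v + Suc m) k = triangle k" for k
      by (induction k) auto
    then show "rec_nat 0 (\<lambda>m v. v + Suc m) (c xs) = triangle (c xs)" for xs by simp
  qed
  show ?thesis
    unfolding prod_encode_def using assms by (auto intro!: total_recursive_add tri)
qed

text \<open>The equations of \<open>search\<close> form a primitive recursion once each test for 1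
  is replaced by zero tests of a number and its predecessor. Entry 1 of \<open>ys\<close> is the
  slot of the previous state.\<close>

lemma total_recursive_search:
  assumes h: "total_recursive (Suc (Suc n)) (\<lambda>ys. h (ys ! 0) (drop 2 ys))"
    and a: "total_recursive n a"
  shows "total_recursive n (\<lambda>xs. search (\<lambda>m. h m xs) (a xs))"
proof (rule total_recursive_cong)
  show "total_recursive n (\<lambda>xs. rec_nat 1
      (\<lambda>m v. if v = 0 then 0 else if v - 1 = 0
         then (if h m xs = 0 then 0 else if h m xs - 1 = 0 then Suc (Suc m) else 1) else v) (a xs))"
    by (intro total_recursive_rec_nat total_recursive_if_zero total_recursive_const
        total_recursive_pred total_recursive_proj total_recursive_Suc a h) auto
  have "rec_nat 1 (\<lambda>m v. if v = 0 then 0 else if v - 1 = 0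
         then (if h m = 0 then 0 else if h m - 1 = 0 then Suc (Suc m) else 1) else v) k = search h k"
    for h k by (induction k) auto
  then show "rec_nat 1
      (\<lambda>m v. if v = 0 then 0 else if v - 1 = 0
         then (if h m xs = 0 then 0 else if h m xs - 1 = 0 then Suc (Suc m) else 1) else v) (a xs)
      = search (\<lambda>m. h m xs) (a xs)" for xs .
qed

text \<open>For fixed \<open>f\<close> the clocked evaluation is assembled from the closure
  properties by induction on \<open>f\<close>, without an interpreter for codes. The arity is left
  arbitrary because subterms are called with other numbers of arguments.\<close>

lemma total_recursive_clocked:
  "total_recursive (Suc n) (\<lambda>xs. clocked f (xs ! 0) (drop 1 xs))"
proof (induction f arbitrary: n)
  case Zero
  show ?case by (simp add: total_recursive_const)
next
  case Succ
  have "total_recursive (Suc n) (\<lambda>xs. if n = 0 then 0 else Suc (Suc (xs ! 1)))"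
    by (cases "n = 0") (auto intro!: total_recursive_const total_recursive_Suc total_recursive_proj)
  then show ?case
    by (rule total_recursive_cong) (auto simp: hd_conv_nth)
next
  case (Proj i)
  have "total_recursive (Suc n) (\<lambda>xs. if i < n then Suc (xs ! (Suc i)) else 0)"
    by (cases "i < n") (auto intro!: total_recursive_const total_recursive_Suc total_recursive_proj)
  then show ?case
    by (rule total_recursive_cong) auto
next
  case (Comp f gs)
  let ?v = "\<lambda>g xs. clocked g (xs ! 0) (drop 1 xs)"
  have args: "total_recursive (Suc n) (\<lambda>xs. clocked f (xs ! 0) (map (\<lambda>g. ?v g xs - 1) gs))"
  proof (rule total_recursive_cong)
    show "total_recursive (Suc n) (\<lambda>xs. (\<lambda>ys. clocked f (ys ! 0) (drop 1 ys))
        (map (\<lambda>\<psi>. \<psi> xs) ((\<lambda>xs. xs ! 0) # map (\<lambda>g xs. ?v g xs - 1) gs)))"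
      using Comp by (intro total_recursive_comp)
        (auto intro!: total_recursive_proj total_recursive_pred[unfolded One_nat_def])
  qed (simp add: comp_def)
  \<comment> \<open>The search for a 0 among the inner values is unrolled into one zero test per
    term. The list \<open>hs\<close> varies in the induction while the final branch keeps all of
    \<open>gs\<close>.\<close>
  have "total_recursive (Suc n) (\<lambda>xs. if \<exists>g\<in>set hs. ?v g xs = 0 then 0
      else clocked f (xs ! 0) (map (\<lambda>g. ?v g xs - 1) gs))" if "set hs \<subseteq> set gs" for hs
    using that
  proof (induction hs)
    case Nil
    show ?case using args by simp
  next
    case (Cons h hs)
    have "total_recursive (Suc n) (\<lambda>xs. if ?v h xs = 0 then 0 else
        if \<exists>g\<in>set hs. ?v g xs = 0 then 0 else clocked f (xs ! 0) (map (\<lambda>g. ?v g xs - 1) gs))"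
      using Cons Comp.IH(2) by (intro total_recursive_if_zero total_recursive_const) auto
    then show ?case by (rule total_recursive_cong) auto
  qed
  from this[OF subset_refl] show ?case
    by (elim total_recursive_cong) (auto simp: Let_def comp_def image_iff)
next
  case (PrimRec f g)
  show ?case
  proof (cases n)
    case 0
    have "total_recursive (Suc n) (\<lambda>_. 0)" by (rule total_recursive_const)
    then show ?thesis by (rule total_recursive_cong) (simp add: 0)
  next
    case (Suc k)
    have b: "total_recursive (Suc n) (\<lambda>xs. clocked f (xs ! 0) (drop 2 xs))"
    proof (rule total_recursive_cong)
      show "total_recursive (Suc n) (\<lambda>xs. (\<lambda>ys. clocked f (ys ! 0) (drop 1 ys))
        (map (\<lambda>\<psi>. \<psi> xs) ((\<lambda>xs. xs ! 0) # map (\<lambda>i xs. xs ! (2 + i)) [0..<k])))"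
        using PrimRec.IH(1)[of k]
        by (intro total_recursive_comp) (auto simp: Suc intro!: total_recursive_proj)
      have "map (\<lambda>i. xs ! (2 + i)) [0..<k] = drop 2 xs" if "length xs = Suc n" for xs :: "nat list"
        using that Suc by (intro nth_equalityI) auto
      then show "(\<lambda>ys. clocked f (ys ! 0) (drop 1 ys))
        (map (\<lambda>\<psi>. \<psi> xs) ((\<lambda>xs. xs ! 0) # map (\<lambda>i xs. xs ! (2 + i)) [0..<k]))
        = clocked f (xs ! 0) (drop 2 xs)" if "length xs = Suc n" for xs
        using that by (simp add: comp_def)
    qed
    \<comment> \<open>Here \<open>ys\<close> lists the recursion index, the previous value, the
      clock, the original recursion argument and \<open>k\<close> parameters, so the clock is entry
      2 and the parameters start at entry 4.\<close>
    have c: "total_recursive (Suc (Suc (Suc n))) (\<lambda>ys. if ys ! 1 = 0 then 0 else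
        clocked g (drop 2 ys ! 0) (ys ! 0 # (ys ! 1 - 1) # drop 2 (drop 2 ys)))"
    proof (intro total_recursive_if_zero total_recursive_const total_recursive_proj)
      show "total_recursive (Suc (Suc (Suc n)))
        (\<lambda>ys. clocked g (drop 2 ys ! 0) (ys ! 0 # (ys ! 1 - 1) # drop 2 (drop 2 ys)))"
      proof (rule total_recursive_cong)
        show "total_recursive (Suc (Suc (Suc n))) (\<lambda>xs. (\<lambda>ys. clocked g (ys ! 0) (drop 1 ys))
        (map (\<lambda>\<psi>. \<psi> xs) ((\<lambda>xs. xs ! 2) # (\<lambda>xs. xs ! 0) # (\<lambda>xs. xs ! 1 - 1)
           # map (\<lambda>i xs. xs ! (4 + i)) [0..<k])))"
          using PrimRec.IH(2)[of "Suc (Suc k)"]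
          by (intro total_recursive_comp)
            (auto simp: Suc intro!: total_recursive_proj
              total_recursive_pred[unfolded One_nat_def])
        have "map (\<lambda>i. xs ! (4 + i)) [0..<k] = drop 2 (drop 2 xs)"
          if "length xs = Suc (Suc (Suc n))" for xs :: "nat list"
          using that Suc by (intro nth_equalityI) auto
        then show "(\<lambda>ys. clocked g (ys ! 0) (drop 1 ys))
        (map (\<lambda>\<psi>. \<psi> xs) ((\<lambda>xs. xs ! 2) # (\<lambda>xs. xs ! 0) # (\<lambda>xs. xs ! 1 - 1)
           # map (\<lambda>i xs. xs ! (4 + i)) [0..<k]))
          = clocked g (drop 2 xs ! 0) (xs ! 0 # (xs ! 1 - 1) # drop 2 (drop 2 xs))"
          if "length xs = Suc (Suc (Suc n))" for xs
          using that by (simp add: comp_def)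
      qed
    qed simp
    have "total_recursive (Suc n) (\<lambda>xs. rec_nat (clocked f (xs ! 0) (drop 2 xs))
        (\<lambda>m v. if v = 0 then 0 else clocked g (xs ! 0) (m # (v - 1) # drop 2 xs)) (xs ! 1))"
      using b c Suc by (intro total_recursive_rec_nat total_recursive_proj) auto
    then show ?thesis
      by (rule total_recursive_cong) (auto simp: Suc length_Suc_conv cong: if_cong)
  qed
next
  case (Mu f)
  let ?h = "\<lambda>m xs. clocked f (xs ! 0) (m # drop 1 xs)"
  have h: "total_recursive (Suc (Suc (Suc n))) (\<lambda>ys. ?h (ys ! 0) (drop 2 ys))"
  proof (rule total_recursive_cong)
    show "total_recursive (Suc (Suc (Suc n))) (\<lambda>xs. (\<lambda>ys. clocked f (ys ! 0) (drop 1 ys))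
        (map (\<lambda>\<psi>. \<psi> xs) ((\<lambda>xs. xs ! 2) # (\<lambda>xs. xs ! 0) # map (\<lambda>i xs. xs ! (3 + i)) [0..<n])))"
      using Mu[of "Suc n"] by (intro total_recursive_comp) (auto intro!: total_recursive_proj)
    have "map (\<lambda>i. xs ! (3 + i)) [0..<n] = drop 1 (drop 2 xs)"
      if "length xs = Suc (Suc (Suc n))" for xs :: "nat list"
      using that by (intro nth_equalityI) (auto simp: numeral_3_eq_3)
    then show "(\<lambda>ys. clocked f (ys ! 0) (drop 1 ys))
        (map (\<lambda>\<psi>. \<psi> xs) ((\<lambda>xs. xs ! 2) # (\<lambda>xs. xs ! 0) # map (\<lambda>i xs. xs ! (3 + i)) [0..<n]))
        = ?h (xs ! 0) (drop 2 xs)" if "length xs = Suc (Suc (Suc n))" for xs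
      using that by (simp add: comp_def)
  qed
  from h have "total_recursive (Suc n) (\<lambda>xs. search (\<lambda>m. ?h m xs) (xs ! 0))"
    by (intro total_recursive_search total_recursive_proj) auto
  then show ?case by (auto dest: total_recursive_pred)
qed


section \<open>A constructive real that depends on its own code\<close>

section \<open>The diagonal plan\<close>

text \<open>The condition \<open>h s = 2\<close> stands for output 1 under clock \<open>s\<close>.
  Recoding by 1 and 2 makes a hit look like a zero and avoids the failure state of
  \<open>search\<close>; the result is \<open>Suc s\<close> for the first hit \<open>s < n\<close>,
  and 0 if there is none. As 1 / 0 = 0, its reciprocal is the desired approximation.\<close>

definition first_hit :: "(nat \<Rightarrow> nat) \<Rightarrow> nat \<Rightarrow> nat" where
  "first_hit h n = search (\<lambda>s. if h s = 2 then 1 else 2) n - 1"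

lemma first_hit_eq_Suc_iff:
  "first_hit h n = Suc s \<longleftrightarrow> s < n \<and> h s = 2 \<and> (\<forall>t<s. h t \<noteq> 2)"
proof -
  have "first_hit h n = Suc s \<longleftrightarrow> search (\<lambda>s. if h s = 2 then 1 else 2) n = Suc (Suc s)"
    by (auto simp: first_hit_def)
  then show ?thesis by (auto simp: search_eq_Suc_Suc_iff)
qed

lemma first_hit_stable: "first_hit h m = Suc s \<Longrightarrow> s < n \<Longrightarrow> first_hit h n = Suc s"
  by (auto simp: first_hit_eq_Suc_iff)

lemma first_hit_unique:
  "first_hit h m = Suc s \<Longrightarrow> first_hit h n = Suc t \<Longrightarrow> s = t"
  by (auto simp: first_hit_eq_Suc_iff) (metis linorder_less_linear)

lemma first_hit_ex: "h s = 2 \<Longrightarrow> \<exists>n t. first_hit h n = Suc t"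
  unfolding first_hit_eq_Suc_iff using exists_least_iff[of "\<lambda>s. h s = 2"] by blast

text \<open>If \<epsilon> = a / b in lowest terms, then \<epsilon> b = a is at least 1, and neither
  the coding of integers nor the pairing makes the denominator \<open>b\<close> smaller.\<close>

lemma rat_encode_bound:
  fixes \<epsilon> :: rat
  assumes "\<epsilon> > 0"
  shows "1 \<le> \<epsilon> * of_nat (rat_encode \<epsilon>)"
proof -
  obtain a b where q: "quotient_of \<epsilon> = (a, b)" by (cases "quotient_of \<epsilon>")
  have b: "b > 0" using q quotient_of_denom_pos by blast
  have \<epsilon>: "\<epsilon> = of_int a / of_int b" using q quotient_of_div by blast
  have "a > 0" using assms b by (simp add: \<epsilon> zero_less_divide_iff)
  have "b \<le> int (int_encode b)" using b by (simp add: int_encode_def sum_encode_def)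
  also have "\<dots> \<le> int (rat_encode \<epsilon>)" by (simp add: rat_encode_def q le_prod_encode_2)
  finally have "(of_int b :: rat) \<le> of_int (int (rat_encode \<epsilon>))" by (simp only: of_int_le_iff)
  then have "\<epsilon> * of_int b \<le> \<epsilon> * of_nat (rat_encode \<epsilon>)"
    using assms by (intro mult_left_mono) auto
  moreover have "\<epsilon> * of_int b = of_int a" using b by (simp add: \<epsilon>)
  moreover have "(1 :: rat) \<le> of_int a" using \<open>a > 0\<close> by simp
  ultimately show ?thesis by linarith
qed

text \<open>The explicit code shows that coding the reciprocal is computable from \<open>u\<close>.
  The case 0 is the fraction 0 / 1, since 1 / 0 = 0.\<close>

lemma rat_encode_inverse_of_nat:
  "rat_encode (1 / of_nat u) = (if u = 0 then prod_encode (0, 2) else prod_encode (2, u + u))"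
proof (cases "u = 0")
  case True
  then show ?thesis by (simp add: rat_encode_def int_encode_def sum_encode_def)
next
  case False
  then have "1 / of_nat u = Fract 1 (int u)" by (simp add: Fract_of_int_quotient)
  moreover have "quotient_of (Fract 1 (int u)) = (1, int u)"
    using False by (simp add: quotient_of_Fract normalize_stable)
  ultimately show ?thesis using False
    by (simp add: rat_encode_def int_encode_def sum_encode_def mult_2)
qed

text \<open>
  The identity is a modulus of convergence on codes of rationals: the code of \<open>\<epsilon>\<close> is at least
  \<open>1 / \<epsilon>\<close>, and a jump of the sequence after index \<open>N\<close> is smaller than \<open>1 / N\<close>.
\<close>

lemma is_crn_first_hit:
  assumes "\<And>n. evals F [n] (rat_encode (1 / of_nat (first_hit h n)))"
  shows "is_crn (F, Proj 0)"
    and "crn_approx (F, Proj 0) n = 1 / of_nat (first_hit h n)"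
proof -
  have approx: "crn_approx (F, Proj 0) n = 1 / of_nat (first_hit h n)" for n
    using assms by (intro crn_approx_eqI) simp
  then show "crn_approx (F, Proj 0) n = 1 / of_nat (first_hit h n)" .
  have jump: "\<bar>1 / of_nat (first_hit h m) - 1 / of_nat (first_hit h n)\<bar> < \<epsilon>"
    if "\<epsilon> > 0" "m > rat_encode \<epsilon>" "first_hit h m = 0" for \<epsilon> :: rat and m n
  proof (cases "first_hit h n")
    case 0
    with that show ?thesis by simp
  next
    case (Suc s)
    \<comment> \<open>A hit before \<open>m\<close> would already be visible at \<open>m\<close>.
      Hence \<open>Suc s\<close> exceeds the code of \<epsilon>, and the jump 1 / (s + 1) is below
      \<epsilon>.\<close>
    then have "m \<le> s" using first_hit_stable that(3) by (metis nat.distinct(1) not_le)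
    have "1 \<le> \<epsilon> * of_nat (rat_encode \<epsilon>)" using that(1) by (rule rat_encode_bound)
    also have "\<dots> < \<epsilon> * of_nat (Suc s)"
      using that(1,2) \<open>m \<le> s\<close> by (intro mult_strict_left_mono) (simp_all only: of_nat_less_iff)
    finally show ?thesis using that(3) Suc by (simp add: divide_less_eq del: of_nat_Suc)
  qed
  have "\<bar>1 / of_nat (first_hit h m) - 1 / of_nat (first_hit h n)\<bar> < \<epsilon>"
    if "\<epsilon> > 0" "m > rat_encode \<epsilon>" "n > rat_encode \<epsilon>" for \<epsilon> :: rat and m n
  proof (cases "first_hit h m = 0 \<or> first_hit h n = 0")
    case True
    then show ?thesis using jump that by (metis abs_minus_commute)
  next
    case False
    then have "first_hit h m = first_hit h n" using first_hit_unique by (metis not0_implies_Suc)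
    then show ?thesis using that by simp
  qed
  moreover have "evals (Proj 0) [k] k" for k using evals.proj[of 0 "[k]"] by simp
  ultimately show "is_crn (F, Proj 0)"
    unfolding is_crn_def approx using assms by fastforce
qed

text \<open>Each layer \<open>Comp Succ [_]\<close> contributes the tag 3 and the singleton list
  code \<open>Suc (prod_encode (v, 0))\<close>. Thus the code of a numeral term is primitive
  recursive in the numeral.\<close>

lemma recf_encode_const_recf:
  "recf_encode (const_recf k) = rec_nat (recf_encode Zero)
     (\<lambda>_ v. prod_encode (3, prod_encode (recf_encode Succ, Suc (prod_encode (v, 0))))) k"
  by (induction k) auto

text \<open>\<open>W\<close> receives its own code through a constant term; this explicit
  self-application takes the place of the recursion theorem.\<close>

definition diagonal_crn :: "recf \<Rightarrow> crn" where
  "diagonal_crn W = (Comp W [const_recf (recf_encode W), Proj 0], Proj 0)"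

text \<open>The code of the diagonal plan as a function of the code \<open>k\<close> of
  \<open>W\<close> alone, so that a program can compute it from an argument \<open>k\<close> before
  \<open>W\<close> is fixed.\<close>

definition diagonal_code :: "nat \<Rightarrow> nat" where
  "diagonal_code k = list_encode [prod_encode (prod_encode (3, prod_encode (k,
     list_encode [recf_encode (const_recf k), recf_encode (Proj 0)])), recf_encode (Proj 0))]"

lemma plan_encode_diagonal: "plan_encode [diagonal_crn W] = diagonal_code (recf_encode W)"
  by (simp add: plan_encode_def crn_encode_def diagonal_crn_def diagonal_code_def)

lemma total_recursive_diagonal_code:
  assumes "total_recursive n a"
  shows "total_recursive n (\<lambda>xs. diagonal_code (a xs))"
proof -
  have "total_recursive n (\<lambda>xs. recf_encode (const_recf (a xs)))"
    unfolding recf_encode_const_recf using assms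
    by (intro total_recursive_rec_nat total_recursive_prod_encode total_recursive_Suc
        total_recursive_const total_recursive_proj) auto
  then show ?thesis
    unfolding diagonal_code_def list_encode.simps using assms
    by (intro total_recursive_prod_encode total_recursive_Suc total_recursive_const)
qed

text \<open>The term \<open>W\<close> takes \<open>k\<close> and \<open>n\<close> and simulates
  \<open>D\<close> on the plan with code \<open>diagonal_code k\<close>. When \<open>k\<close> is
  the code of \<open>W\<close> itself, that plan is the diagonal one.\<close>

lemma diagonal_exists:
  "\<exists>W. \<forall>n. evals (fst (diagonal_crn W)) [n]
     (rat_encode (1 / of_nat (first_hit (\<lambda>s. clocked D s [c, plan_encode [diagonal_crn W]]) n)))"
proof -
  define h where "h k s = clocked D s [c, diagonal_code k]" for k s
  \<comment> \<open>Entry 0 of \<open>ys\<close> is the clock tried by the search, entry 1 the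
    search state, and entries 2 and 3 are \<open>k\<close> and \<open>n\<close>.\<close>
  have "total_recursive (Suc (Suc 2)) (\<lambda>ys. (\<lambda>zs. clocked D (zs ! 0) (drop 1 zs))
      (map (\<lambda>\<psi>. \<psi> ys) [\<lambda>ys. ys ! 0, \<lambda>_. c, \<lambda>ys. diagonal_code (ys ! 2)]))"
    using total_recursive_clocked[of 2 D]
    by (intro total_recursive_comp)
      (auto simp: numeral_3_eq_3 numeral_2_eq_2
        intro!: total_recursive_proj total_recursive_const total_recursive_diagonal_code)
  then have h: "total_recursive (Suc (Suc 2)) (\<lambda>ys. h (drop 2 ys ! 0) (ys ! 0))"
    by (rule total_recursive_cong) (simp add: h_def)
  \<comment> \<open>The values 0 and 1 are excluded before 2 is tested, since truncated predecessors
    would confuse them with 2.\<close>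
  then have "total_recursive (Suc (Suc 2)) (\<lambda>ys. if h (drop 2 ys ! 0) (ys ! 0) = 0 then 2 else
      if h (drop 2 ys ! 0) (ys ! 0) - 1 = 0 then 2 else
      if h (drop 2 ys ! 0) (ys ! 0) - 1 - 1 = 0 then 1 else 2)"
    by (intro total_recursive_if_zero total_recursive_pred total_recursive_const)
  then have "total_recursive (Suc (Suc 2))
      (\<lambda>ys. if h (drop 2 ys ! 0) (ys ! 0) = 2 then 1 else 2)"
    by (rule total_recursive_cong) auto
  then have "total_recursive 2 (\<lambda>xs. first_hit (h (xs ! 0)) (xs ! 1))"
    unfolding first_hit_def
    by (intro total_recursive_pred total_recursive_search total_recursive_proj) auto
  then have "total_recursive 2 (\<lambda>xs. rat_encode (1 / of_nat (first_hit (h (xs ! 0)) (xs ! 1))))"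
    unfolding rat_encode_inverse_of_nat
    by (intro total_recursive_if_zero total_recursive_prod_encode total_recursive_add
        total_recursive_const)
  then obtain W where "\<And>xs. length xs = 2 \<Longrightarrow>
      evals W xs (rat_encode (1 / of_nat (first_hit (h (xs ! 0)) (xs ! 1))))"
    unfolding total_recursive_def by blast
  from this[of "[_, _]"]
  have W: "evals W [k, n] (rat_encode (1 / of_nat (first_hit (h k) n)))" for k n by simp
  have "evals (fst (diagonal_crn W)) [n] (rat_encode (1 / of_nat (first_hit (h (recf_encode W)) n)))" for n
    unfolding diagonal_crn_def fst_conv
    by (rule evals.comp[OF _ W]) (use evals.proj[of 0 "[n]"] evals_const_recf in auto)
  then show ?thesis unfolding plan_encode_diagonal h_def by blast
qed


section \<open>A fixed one-variable problem and the contradiction\<close>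

section \<open>The problem with the single constraint \<open>x = 0\<close>\<close>

definition const_crn :: "rat \<Rightarrow> crn" where
  "const_crn q = (const_recf (rat_encode q), Zero)"

lemma crn_approx_const_crn [simp]: "crn_approx (const_crn q) n = q"
  by (rule crn_approx_eqI) (simp add: const_crn_def evals_const_recf)

lemma is_crn_const_crn [simp]: "is_crn (const_crn q)"
  unfolding is_crn_def
  by (auto simp: const_crn_def[symmetric]) (auto simp: const_crn_def intro: evals_const_recf evals.zero)

definition zero_clpp :: clpp where
  "zero_clpp = CLPP True [const_crn 1] [Constr [const_crn 1] EQ (const_crn 0)]"

lemma is_clpp_zero_clpp: "is_clpp zero_clpp"
  by (simp add: is_clpp_def zero_clpp_def num_vars_def)

lemma is_plan_zero_clpp: "is_plan zero_clpp p \<longleftrightarrow> (\<exists>x. p = [x] \<and> is_crn x)"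
  by (auto simp: is_plan_def zero_clpp_def num_vars_def length_Suc_conv)

lemma allowable_zero_clpp:
  "allowable zero_clpp p \<longleftrightarrow> (\<exists>x. p = [x] \<and> is_crn x \<and> approx_eq (crn_approx x) (\<lambda>_. 0))"
proof -
  have "lin_form [const_crn 1] [x] = crn_approx x" for x
    by (simp add: lin_form_def fun_eq_iff)
  moreover have "crn_approx (const_crn 0) = (\<lambda>_. 0)" by (simp add: fun_eq_iff)
  ultimately show ?thesis
    unfolding allowable_def is_plan_zero_clpp by (auto simp: zero_clpp_def)
qed

lemma approx_eq_refl: "(\<And>n. x n = y) \<Longrightarrow> approx_eq x (\<lambda>_. y)"
  unfolding approx_eq_def by (intro exI[of _ Zero]) (auto intro: evals.zero)

lemma nonempty_zero_clpp: "nonempty_clpp zero_clpp"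
  unfolding nonempty_clpp_def allowable_zero_clpp
  by (intro exI[of _ "[const_crn 0]"] exI[of _ "const_crn 0"]) (simp add: approx_eq_refl)

lemma bounded_zero_clpp: "bounded_clpp zero_clpp"
  unfolding bounded_clpp_def allowable_zero_clpp approx_eq_def approx_le_def
  \<comment> \<open>The algorithm witnessing x = 0 makes |x(n)| < \<epsilon>, that is 0 > |x(n)| -
    \<epsilon>, so it also witnesses the bound 0.\<close>
  by (rule exI[of _ 0]) fastforce

theorem theorem4:
  shows "\<not> (\<exists>D::recf. \<forall>P p.
           is_clpp P \<and> nonempty_clpp P \<and> bounded_clpp P \<and> is_plan P p \<longrightarrow>
             evals D [clpp_encode P, plan_encode p] (of_bool (allowable P p)))"
proof
  assume "\<exists>D::recf. \<forall>P p.
           is_clpp P \<and> nonempty_clpp P \<and> bounded_clpp P \<and> is_plan P p \<longrightarrow>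
             evals D [clpp_encode P, plan_encode p] (of_bool (allowable P p))"
  then obtain D where D: "\<And>P p. is_clpp P \<Longrightarrow> nonempty_clpp P \<Longrightarrow> bounded_clpp P \<Longrightarrow> is_plan P p \<Longrightarrow>
      evals D [clpp_encode P, plan_encode p] (of_bool (allowable P p))" by blast
  obtain W where W: "\<And>n. evals (fst (diagonal_crn W)) [n] (rat_encode (1 / of_nat (first_hit
      (\<lambda>s. clocked D s [clpp_encode zero_clpp, plan_encode [diagonal_crn W]]) n)))"
    using diagonal_exists by blast
  define x where "x = diagonal_crn W"
  define h where "h s = clocked D s [clpp_encode zero_clpp, plan_encode [x]]" for s
  have x: "(fst x, Proj 0) = x" by (simp add: x_def diagonal_crn_def)
  from W have "evals (fst x) [n] (rat_encode (1 / of_nat (first_hit h n)))" for n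
    by (simp add: x_def h_def[abs_def])
  from is_crn_first_hit[of "fst x" h, OF this, unfolded x]
  have crn: "is_crn x" and approx: "crn_approx x n = 1 / of_nat (first_hit h n)" for n by auto
  have dec: "evals D [clpp_encode zero_clpp, plan_encode [x]] (of_bool (allowable zero_clpp [x]))"
    using crn by (intro D is_clpp_zero_clpp nonempty_zero_clpp bounded_zero_clpp)
      (simp add: is_plan_zero_clpp)
  show False
  proof (cases "allowable zero_clpp [x]")
    case True
    with dec have "evals D [clpp_encode zero_clpp, plan_encode [x]] 1" by simp
    then obtain s where "h s = Suc 1" unfolding h_def using clocked_complete by blast
    then have "h s = 2" by simp
    then obtain N t where hit: "first_hit h N = Suc t" using first_hit_ex by blast
    from True obtain A where "\<And>\<epsilon>. \<epsilon> > 0 \<Longrightarrow> \<exists>M. \<forall>m>M. \<bar>crn_approx x m\<bar> < \<epsilon>"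
      unfolding allowable_zero_clpp approx_eq_def by fastforce
    \<comment> \<open>This \<epsilon> is the value that \<open>x\<close> keeps after the hit at
      \<open>t\<close>; the index \<open>M + t + 1\<close> lies beyond both \<open>M\<close> and
      \<open>t\<close>, so the strict bound fails there.\<close>
    from this[of "1 / of_nat (Suc t)"] obtain M
      where "\<bar>crn_approx x m\<bar> < 1 / of_nat (Suc t)" if "m > M" for m by auto
    from this[of "M + t + 1"] show False
      using first_hit_stable[OF hit, of "M + t + 1"] by (simp add: approx)
  next
    case False
    \<comment> \<open>Rejection means output 0, and determinism then excludes output 1 under every
      clock. So all approximations are 1 / 0 = 0 and the rejected plan is allowable.\<close>
    have "first_hit h n = 0" for n
    proof (rule ccontr)
      assume "first_hit h n \<noteq> 0"
      then obtain s where "h s = 2" by (metis first_hit_eq_Suc_iff not0_implies_Suc)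
      then have "evals D [clpp_encode zero_clpp, plan_encode [x]] 1"
        unfolding h_def by (intro clocked_sound[of D s]) simp
      with dec False show False using evals_deterministic by fastforce
    qed
    then have "allowable zero_clpp [x]"
      using crn unfolding allowable_zero_clpp by (auto simp: approx intro!: approx_eq_refl)
    with False show False ..
  qed
qed

end
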